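(* Let $c>0$ and $\lambda>0$. For real $x$ and $t>0$ with $x\in(-ct,ct)$ let $$f(x,t)=\frac{\lambda e^{-\lambda t}}{2c}\left[ I_0\left(\frac{\lambda}{c}\sqrt{c^2t^2-x^2}\right)+\frac{ct}{\sqrt{c^2t^2-x^2}}\, I_1\left(\frac{\lambda}{c}\sqrt{c^2t^2-x^2}\right)\right]$$ be the value at the interior point $x$ of the density of the Goldstein-Kac telegraph process with parameters $(c,\lambda)$, and let $$g(x,t)=\frac{e^{-\lambda t}}{\pi\sqrt{c^2t^2-x^2}}+\frac{\lambda e^{-\lambda t}}{2c}\left[ I_0\left(\frac{\lambda}{c}\sqrt{c^2t^2-x^2}\right)+\mathbf{L}_0\left(\frac{\lambda}{c}\sqrt{c^2t^2-x^2}\right)\right]$$ be the density of the marginals of the planar symmetric Markov random flight with parameters $(c,\lambda)$. Then at an arbitrary fixed point $x\in(-ct,ct)$ (that is, for each fixed real $x$, with $t$ ranging over values satisfying $ct>|x|$), $$|f(x,t)-g(x,t)|=O(t^{-1}),\qquad t\to\infty .$$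
   Context: The modified Bessel functions of orders zero and one and the modified Struve function of order zero are $$I_0(z)=\sum_{k=0}^{\infty}\frac{1}{(k!)^2}\left(\frac z2\right)^{2k},\qquad I_1(z)=\sum_{k=0}^{\infty}\frac{1}{k!\,(k+1)!}\left(\frac z2\right)^{2k+1},\qquad \mathbf{L}_0(z)=\sum_{k=0}^{\infty}\frac{1}{\left[\Gamma\left(k+\frac32\right)\right]^2}\left(\frac z2\right)^{2k+1}.$$ Background: the Goldstein-Kac telegraph process is the position on the real line of a particle starting at $0$ in one of the two directions, moving with constant speed $c$ and reversing direction at the events of a Poisson process of rate $\lambda$. Its full generalized density is $$\frac{e^{-\lambda t}}{2}\left[\delta(ct+x)+\delta(ct-x)\right]+\frac{\lambda e^{-\lambda t}}{2c}\left[ I_0\left(\frac{\lambda}{c}\sqrt{c^2t^2-x^2}\right)+\frac{ct}{\sqrt{c^2t^2-x^2}}\, I_1\left(\frac{\lambda}{c}\sqrt{c^2t^2-x^2}\right)\right]\Theta(ct-|x|),$$ where $\delta$ is the Dirac delta-function and $\Theta$ is the Heaviside step function. The singular part is concentrated at $x=\pm ct$ and vanishes at interior points $x\in(-ct,ct)$. The planar symmetric Markov random flight $(X_1(t),X_2(t))$ is the position of a particle starting at the origin of $\mathbb{R}^2$ and moving with constant speed $c$, whose initial direction, and each new direction taken at the events of a Poisson process of rate $\lambda$, is chosen independently and uniformly on the unit circle. Both marginals $X_1(t)$ and $X_2(t)$ have the density $g(x,t)$, $x\in(-ct,ct)$. *)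

theory Defs
  imports "HOL-Analysis.Analysis" "HOL-Library.Landau_Symbols"
begin

definition bessel_I0 :: "real \<Rightarrow> real" where
  "bessel_I0 z = (\<Sum>k. 1 / (fact k)\<^sup>2 * (z / 2) ^ (2 * k))"

definition bessel_I1 :: "real \<Rightarrow> real" where
  "bessel_I1 z = (\<Sum>k. 1 / (fact k * fact (k + 1)) * (z / 2) ^ (2 * k + 1))"

definition struve_L0 :: "real \<Rightarrow> real" where
  "struve_L0 z = (\<Sum>k. 1 / (Gamma (real k + 3 / 2))\<^sup>2 * (z / 2) ^ (2 * k + 1))"

text \<open>
  Both densities below are meaningful only for \<open>c > 0\<close>, \<open>lam > 0\<close> and \<open>\<bar>x\<bar> < c * t\<close>; their values
  outside this range are irrelevant. The telegraph density is the absolutely continuous part only: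
  the two atoms at \<open>x = \<plusminus>c * t\<close> do not contribute at interior points, where the Heaviside factor
  equals one.
\<close>

definition telegraph_density :: "real \<Rightarrow> real \<Rightarrow> real \<Rightarrow> real \<Rightarrow> real" where
  "telegraph_density c lam x t =
     lam * exp (- lam * t) / (2 * c) *
       (bessel_I0 (lam / c * sqrt (c\<^sup>2 * t\<^sup>2 - x\<^sup>2)) +
        c * t / sqrt (c\<^sup>2 * t\<^sup>2 - x\<^sup>2) * bessel_I1 (lam / c * sqrt (c\<^sup>2 * t\<^sup>2 - x\<^sup>2)))"

definition planar_flight_marginal_density :: "real \<Rightarrow> real \<Rightarrow> real \<Rightarrow> real \<Rightarrow> real" where
  "planar_flight_marginal_density c lam x t =
     exp (- lam * t) / (pi * sqrt (c\<^sup>2 * t\<^sup>2 - x\<^sup>2)) +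
     lam * exp (- lam * t) / (2 * c) *
       (bessel_I0 (lam / c * sqrt (c\<^sup>2 * t\<^sup>2 - x\<^sup>2)) +
        struve_L0 (lam / c * sqrt (c\<^sup>2 * t\<^sup>2 - x\<^sup>2)))"

end

theory Submission
  imports Defs
begin

text \<open>
  Write \<open>s = sqrt (c\<^sup>2 * t\<^sup>2 - x\<^sup>2)\<close> and \<open>z = lam / c * s\<close>, so that \<open>z \<le> lam * t\<close>. The \<open>I\<^sub>0\<close> terms of the
  two densities cancel, and the term \<open>exp (- lam * t) / (pi * s)\<close> is small by itself. What remains is
  \<open>c * t / s * I\<^sub>1 z - \<^bold>L\<^sub>0 z\<close>, which has to be small relative to \<open>exp z\<close>.

  The point is that \<open>\<^bold>L\<^sub>0\<close> and \<open>I\<^sub>1\<close> are power series in the same powers of \<open>z / 2\<close>, with coefficients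
  \<open>1 / \<Gamma>(k + 3/2)\<^sup>2\<close> and \<open>1 / (\<Gamma>(k + 1) * \<Gamma>(k + 2))\<close>. Log-convexity of \<open>\<Gamma>\<close> bounds the former
  from below by the latter, and from above by the latter times \<open>1 + 1 / (2 * (k + 1))\<close>. The extra factor
  \<open>1 / (2 * (k + 1))\<close> turns the series of \<open>I\<^sub>1 z\<close> into that of \<open>(I\<^sub>0 z - 1) / z\<close>, whence
  \<open>0 \<le> \<^bold>L\<^sub>0 z - I\<^sub>1 z \<le> exp z / z\<close> without any asymptotic expansion
  (lemmas \<open>bessel_I1_le_struve_L0\<close> and \<open>struve_L0_minus_bessel_I1_le\<close>).
  Together with \<open>I\<^sub>1 z \<le> exp z\<close> and \<open>c * t / s - 1 \<le> \<bar>x\<bar> / s\<close> this gives a bound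
  for the difference of the densities by a constant over \<open>s\<close>, valid at every interior point
  (lemma \<open>telegraph_planar_density_diff_le\<close>), and \<open>s\<close> is eventually at least \<open>c * t / 2\<close>.
\<close>

section \<open>Series dominated by the exponential series\<close>

lemma subseries_exp_bound:
  fixes f :: "nat \<Rightarrow> real"
  assumes "inj g" and "\<And>k. 0 \<le> f k" and "\<And>k. f k \<le> z ^ g k / fact (g k)" and "z \<ge> 0"
  shows "summable f" and "suminf f \<le> exp z"
proof -
  define e where "e n = z ^ n / fact n" for n
  have e: "summable e" "suminf e = exp z"
    using exp_converges[of z] unfolding e_def
    by (simp_all only: sums_iff scaleR_conv_of_real of_real_inverse of_real_fact of_real_eq_id id_apply divide_inverse mult.commute)
  have e0: "e n \<ge> 0" for n
    using assms(4) by (simp add: e_def)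
  have se: "summable (e \<circ> g)"
    by (rule summable_reindex[OF e(1) assms(1) e0])
  show sf: "summable f"
    by (rule summable_comparison_test'[OF se, of 0]) (use assms in \<open>auto simp: e_def\<close>)
  have "suminf f \<le> suminf (e \<circ> g)"
    by (rule suminf_le[OF _ sf se]) (use assms in \<open>auto simp: e_def\<close>)
  also have "\<dots> \<le> suminf e"
    by (rule suminf_reindex_mono[OF e(1) assms(1) e0])
  finally show "suminf f \<le> exp z"
    using e(2) by simp
qed

text \<open>This is \<open>(m + n) choose m \<le> 2 ^ (m + n)\<close>.\<close>

lemma half_power_over_facts_le:
  fixes z :: real
  assumes "z \<ge> 0"
  shows "1 / (fact m * fact n) * (z / 2) ^ (m + n) \<le> z ^ (m + n) / fact (m + n)"
proof -
  have "real ((m + n) choose m) \<le> 2 ^ (m + n)"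
    using binomial_le_pow2[of "m + n" m] by (metis of_nat_le_iff of_nat_numeral of_nat_power)
  moreover have "real ((m + n) choose m) = fact (m + n) / (fact m * fact n)"
    by (subst binomial_fact) auto
  ultimately have "1 / (fact m * fact n) \<le> (2 ^ (m + n) :: real) / fact (m + n)"
    by (simp add: field_simps)
  then have "1 / (fact m * fact n) * (z / 2) ^ (m + n) \<le> 2 ^ (m + n) / fact (m + n) * (z / 2) ^ (m + n)"
    using assms by (intro mult_right_mono) auto
  then show ?thesis
    by (simp add: power_divide)
qed

lemma bessel_I1_bounds:
  assumes "z \<ge> 0"
  shows bessel_I1_summable: "summable (\<lambda>k. 1 / (fact k * fact (k + 1)) * (z / 2) ^ (2 * k + 1))"
    and bessel_I1_nonneg: "0 \<le> bessel_I1 z"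
    and bessel_I1_le_exp: "bessel_I1 z \<le> exp z"
proof -
  define f where "f k = 1 / (fact k * fact (k + 1)) * (z / 2) ^ (2 * k + 1)" for k
  have f0: "f k \<ge> 0" for k
    using assms by (simp add: f_def)
  have fe: "f k \<le> z ^ (2 * k + 1) / fact (2 * k + 1)" for k
    using half_power_over_facts_le[OF assms, of k "k + 1"] unfolding f_def mult_2 add.assoc .
  have inj: "inj (\<lambda>k. 2 * k + 1 :: nat)"
    by (auto intro: injI)
  note b = subseries_exp_bound[OF inj f0 fe assms]
  from b(1) show "summable (\<lambda>k. 1 / (fact k * fact (k + 1)) * (z / 2) ^ (2 * k + 1))"
    unfolding f_def .
  have I: "bessel_I1 z = suminf f"
    unfolding bessel_I1_def f_def by (rule refl)
  from b show "bessel_I1 z \<le> exp z" "0 \<le> bessel_I1 z"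
    using suminf_nonneg[OF b(1) f0] by (auto simp: I)
qed

section \<open>Log-convexity and the coefficients of the Struve series\<close>

lemma Gamma_half_shift_squared_le:
  fixes y :: real
  assumes "y > 0"
  shows "(Gamma (y + 1 / 2))\<^sup>2 \<le> Gamma y * Gamma (y + 1)"
proof -
  have G: "Gamma y > 0" "Gamma (y + 1) > 0" "Gamma (y + 1 / 2) > 0"
    using assms by (auto intro: Gamma_real_pos)
  have "(ln \<circ> Gamma) ((1 - 1 / 2) *\<^sub>R y + (1 / 2) *\<^sub>R (y + 1))
      \<le> (1 - 1 / 2) * (ln \<circ> Gamma) y + (1 / 2) * (ln \<circ> Gamma) (y + 1)"
    by (rule convex_onD[OF log_convex_Gamma_real]) (use assms in auto)
  moreover have "(1 - 1 / 2) *\<^sub>R y + (1 / 2) *\<^sub>R (y + 1) = y + 1 / 2"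
    by (simp add: field_simps)
  ultimately have "2 * ln (Gamma (y + 1 / 2)) \<le> ln (Gamma y) + ln (Gamma (y + 1))"
    by simp
  then have "ln ((Gamma (y + 1 / 2))\<^sup>2) \<le> ln (Gamma y * Gamma (y + 1))"
    using G by (simp add: ln_mult ln_realpow)
  then show ?thesis
    using G by (simp add: ln_le_cancel_iff)
qed

lemma struve_coeff_ge:
  "1 / (fact k * fact (k + 1)) \<le> 1 / (Gamma (real k + 3 / 2))\<^sup>2"
proof -
  have "(Gamma (real k + 3 / 2))\<^sup>2 \<le> fact k * fact (k + 1)"
    using Gamma_half_shift_squared_le[of "real k + 1"] Gamma_fact[of k, where ?'a = real]
      Gamma_fact[of "k + 1", where ?'a = real]
    by (simp add: add_ac)
  moreover have "Gamma (real k + 3 / 2) > 0"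
    by (rule Gamma_real_pos) simp
  ultimately show ?thesis
    by (intro divide_left_mono mult_pos_pos zero_less_power) auto
qed

text \<open>
  The upper estimate uses log-convexity at the midpoint \<open>k + 2\<close> of \<open>k + 3/2\<close> and \<open>k + 5/2\<close>. The
  allowed excess is the coefficient of \<open>(z / 2) ^ (2 * k + 1)\<close> in \<open>(I\<^sub>0 z - 1) / z\<close>, which is what
  makes the difference of the two functions smaller than \<open>exp z\<close> by a factor of \<open>z\<close>.
\<close>

lemma struve_coeff_le:
  "1 / (Gamma (real k + 3 / 2))\<^sup>2 \<le> 1 / (fact k * fact (k + 1)) + 1 / (2 * (fact (k + 1))\<^sup>2)"
proof -
  define G where "G = Gamma (real k + 3 / 2)"
  define F where "F = (fact k :: real)"
  have G: "G > 0"
    unfolding G_def by (rule Gamma_real_pos) simp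
  have F: "F > 0"
    by (simp add: F_def)
  have F1: "fact (k + 1) = (real k + 1) * F"
    by (simp add: F_def)
  have "(Gamma (real k + 2))\<^sup>2 \<le> G * Gamma (real k + 3 / 2 + 1)"
    using Gamma_half_shift_squared_le[of "real k + 3 / 2"] by (simp add: G_def add_ac)
  moreover have "Gamma (real k + 3 / 2 + 1) = (real k + 3 / 2) * G"
    unfolding G_def by (rule Gamma_plus1) (auto elim!: nonpos_Ints_cases')
  moreover have "Gamma (real k + 2) = (real k + 1) * F"
    using Gamma_fact[of "k + 1", where ?'a = real] by (simp add: F_def add_ac)
  ultimately have "((real k + 1) * F)\<^sup>2 \<le> (real k + 3 / 2) * G\<^sup>2"
    by (simp add: power2_eq_square mult_ac)
  then have "1 / G\<^sup>2 \<le> (real k + 3 / 2) / ((real k + 1) * F)\<^sup>2"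
    using G F by (simp add: divide_simps)
  also have "\<dots> = 1 / (F * ((real k + 1) * F)) + 1 / (2 * ((real k + 1) * F)\<^sup>2)"
    using F by (simp add: divide_simps power2_eq_square)
  finally show ?thesis
    unfolding F1 G_def F_def .
qed

section \<open>Comparison of the Struve and Bessel functions\<close>

lemma
  assumes "z > 0"
  shows bessel_I1_le_struve_L0: "bessel_I1 z \<le> struve_L0 z"
    and struve_L0_minus_bessel_I1_le: "struve_L0 z - bessel_I1 z \<le> exp z / z"
proof -
  define a where "a k = 1 / (fact k * fact (k + 1)) * (z / 2) ^ (2 * k + 1)" for k
  define b where "b k = 1 / (Gamma (real k + 3 / 2))\<^sup>2 * (z / 2) ^ (2 * k + 1)" for k
  \<comment> \<open>the series of \<open>I\<^sub>0 z - 1\<close>\<close>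
  define u where "u k = 1 / (fact (k + 1) * fact (k + 1)) * (z / 2) ^ ((k + 1) + (k + 1))" for k
  have sa: "summable a"
    unfolding a_def by (rule bessel_I1_summable) (use assms in simp)
  have u0: "u k \<ge> 0" for k
    using assms by (simp add: u_def)
  have ue: "u k \<le> z ^ ((k + 1) + (k + 1)) / fact ((k + 1) + (k + 1))" for k
    unfolding u_def by (rule half_power_over_facts_le) (use assms in simp)
  have inj: "inj (\<lambda>k. (k + 1) + (k + 1) :: nat)"
    by (auto intro: injI)
  note u = subseries_exp_bound[OF inj u0 ue less_imp_le[OF assms]]
  have ab: "a k \<le> b k" for k
    unfolding a_def b_def by (rule mult_right_mono[OF struve_coeff_ge]) (use assms in simp)
  have bau: "b k \<le> a k + u k / z" for k
  proof -
    have "b k \<le> (1 / (fact k * fact (k + 1)) + 1 / (2 * (fact (k + 1))\<^sup>2)) * (z / 2) ^ (2 * k + 1)"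
      unfolding b_def by (rule mult_right_mono[OF struve_coeff_le]) (use assms in simp)
    also have "\<dots> = a k + 1 / (2 * (fact (k + 1))\<^sup>2) * (z / 2) ^ (2 * k + 1)"
      by (simp only: a_def distrib_right)
    also have "1 / (2 * (fact (k + 1))\<^sup>2) * (z / 2) ^ (2 * k + 1) = u k / z"
    proof -
      have "(z / 2) ^ ((k + 1) + (k + 1)) = (z / 2) ^ (2 * k + 1) * (z / 2)"
        by (simp add: mult_2)
      moreover have "1 / (2 * (d * d)) * p = 1 / (d * d) * (p * (z / 2)) / z" for d p :: real
        using assms by simp
      ultimately show ?thesis
        unfolding u_def power2_eq_square by (simp only:)
    qed
    finally show ?thesis .
  qed
  have sau: "summable (\<lambda>k. a k + u k / z)"
    using sa u(1) by (intro summable_add summable_divide)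
  have sb: "summable b"
  proof (rule summable_comparison_test'[OF sau, of 0])
    show "norm (b k) \<le> a k + u k / z" for k
      using bau[of k] assms by (simp add: b_def)
  qed
  have I: "bessel_I1 z = suminf a" and L: "struve_L0 z = suminf b"
    unfolding bessel_I1_def struve_L0_def a_def b_def by (rule refl)+
  show "bessel_I1 z \<le> struve_L0 z"
    unfolding I L by (rule suminf_le[OF ab sa sb])
  have "suminf b \<le> (\<Sum>k. a k + u k / z)"
    by (rule suminf_le[OF bau sb sau])
  also have "\<dots> = suminf a + suminf u / z"
    using suminf_add[OF sa summable_divide[OF u(1)]] suminf_divide[OF u(1)] by metis
  also have "\<dots> \<le> suminf a + exp z / z"
    using u(2) assms by (simp add: divide_right_mono)
  finally show "struve_L0 z - bessel_I1 z \<le> exp z / z"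
    by (simp add: I L)
qed

section \<open>Comparison of the densities\<close>

text \<open>
  The three contributions to the constant are \<open>1\<close> for the term \<open>exp (- lam * t) / (pi * s)\<close> of the
  planar density, \<open>lam * \<bar>x\<bar> / (2 * c)\<close> for replacing the factor \<open>c * t / s\<close> by \<open>1\<close>, and \<open>1 / 2\<close> for
  replacing \<open>I\<^sub>1\<close> by \<open>\<^bold>L\<^sub>0\<close>, since \<open>lam / (2 * c) * (1 / z) = 1 / (2 * s)\<close>.
\<close>

lemma telegraph_planar_density_diff_le:
  fixes c lam x t :: real
  assumes c: "c > 0" and lam: "lam > 0" and x: "\<bar>x\<bar> < c * t"
  shows "\<bar>telegraph_density c lam x t - planar_flight_marginal_density c lam x t\<bar>
    \<le> (3 / 2 + lam * \<bar>x\<bar> / (2 * c)) / sqrt (c\<^sup>2 * t\<^sup>2 - x\<^sup>2)"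
proof -
  define s where "s = sqrt (c\<^sup>2 * t\<^sup>2 - x\<^sup>2)"
  define z where "z = lam / c * s"
  define E where "E = exp (- lam * t)"
  define A where "A = (c * t / s - 1) * bessel_I1 z"
  define B where "B = struve_L0 z - bessel_I1 z"
  have ct: "c * t > 0"
    using x by linarith
  then have t: "t > 0"
    using c by (rule zero_less_mult_pos)
  have "\<bar>x\<bar>\<^sup>2 < (c * t)\<^sup>2"
    using x by (intro power_strict_mono) auto
  then have pos: "c\<^sup>2 * t\<^sup>2 - x\<^sup>2 > 0"
    by (simp add: power_mult_distrib)
  then have s: "s > 0"
    by (simp add: s_def)
  have s2: "s\<^sup>2 = (c * t)\<^sup>2 - x\<^sup>2"
    using pos by (simp add: s_def power_mult_distrib)
  have s_le: "s \<le> c * t"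
    by (rule power2_le_imp_le) (use s2 ct in auto)
  have "c * t \<le> \<bar>x\<bar> + s"
  proof (rule power2_le_imp_le)
    have "(\<bar>x\<bar> + s)\<^sup>2 = (c * t)\<^sup>2 + 2 * \<bar>x\<bar> * s"
      using s2 by (simp add: power2_sum)
    then show "(c * t)\<^sup>2 \<le> (\<bar>x\<bar> + s)\<^sup>2"
      using s by simp
  qed (use s in simp)
  then have ratio: "c * t / s - 1 \<le> \<bar>x\<bar> / s"
    using s divide_right_mono[of "c * t" "\<bar>x\<bar> + s" s] by (simp add: add_divide_distrib)
  have ratio0: "0 \<le> c * t / s - 1"
    using s s_le by simp
  have z: "z > 0"
    using c lam s by (simp add: z_def)
  have zt: "z \<le> lam * t"
    using c lam s_le by (simp add: z_def field_simps)
  have E0: "E > 0"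
    by (simp add: E_def)
  have E1: "E \<le> 1"
    using lam t by (simp add: E_def)
  have Ez: "E * exp z \<le> 1"
    using zt by (simp add: E_def flip: exp_add)
  have A0: "A \<ge> 0" and B0: "B \<ge> 0"
    using ratio0 bessel_I1_nonneg[of z] bessel_I1_le_struve_L0[OF z] z by (auto simp: A_def B_def)
  have "A \<le> \<bar>x\<bar> / s * exp z"
    unfolding A_def using ratio bessel_I1_le_exp[of z] bessel_I1_nonneg[of z] z s
    by (intro mult_mono) auto
  then have "E * A \<le> (E * exp z) * (\<bar>x\<bar> / s)"
    using E0 mult_left_mono[of A "\<bar>x\<bar> / s * exp z" E] by (simp add: mult_ac)
  also have "\<dots> \<le> 1 * (\<bar>x\<bar> / s)"
    using s by (intro mult_right_mono Ez) auto
  finally have EA: "E * A \<le> \<bar>x\<bar> / s"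
    by simp
  have "E * B \<le> (E * exp z) * (1 / z)"
    using E0 mult_left_mono[OF struve_L0_minus_bessel_I1_le[OF z], of E] by (simp add: B_def)
  also have "\<dots> \<le> 1 * (1 / z)"
    using z by (intro mult_right_mono Ez) auto
  finally have EB: "E * B \<le> c / (lam * s)"
    by (simp add: z_def)
  have EP: "E / (pi * s) \<le> 1 / s"
  proof -
    have "E \<le> pi"
      using E1 pi_gt3 by linarith
    then show ?thesis
      using s by (simp add: field_simps)
  qed
  have cancel_I0: "w * (i + r * j) - (p + w * (i + l)) = w * ((r - 1) * j) - w * (l - j) - p"
    for w i r j l p :: real
    by (simp add: algebra_simps)
  have "telegraph_density c lam x t - planar_flight_marginal_density c lam x t
      = lam * E / (2 * c) * A - lam * E / (2 * c) * B - E / (pi * s)"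
    unfolding telegraph_density_def planar_flight_marginal_density_def
      s_def[symmetric] z_def[symmetric] E_def[symmetric] A_def B_def
    by (rule cancel_I0)
  also have "\<dots> = lam / (2 * c) * (E * A) - lam / (2 * c) * (E * B) - E / (pi * s)"
    by simp
  also have "\<bar>\<dots>\<bar> \<le> lam / (2 * c) * (E * A) + lam / (2 * c) * (E * B) + E / (pi * s)"
  proof -
    have "0 \<le> lam / (2 * c) * (E * A)" "0 \<le> lam / (2 * c) * (E * B)" "0 \<le> E / (pi * s)"
      using lam c E0 A0 B0 s by auto
    then show ?thesis
      by linarith
  qed
  also have "\<dots> \<le> lam / (2 * c) * (\<bar>x\<bar> / s) + lam / (2 * c) * (c / (lam * s)) + 1 / s"
    using lam c by (intro add_mono mult_left_mono EA EB EP) auto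
  also have "\<dots> = (3 / 2 + lam * \<bar>x\<bar> / (2 * c)) / s"
    using lam c s by (simp add: field_simps)
  finally show ?thesis
    by (simp add: s_def)
qed

theorem theorem2:
  fixes c lam x :: real
  assumes "c > 0" and "lam > 0"
  shows "(\<lambda>t. \<bar>telegraph_density c lam x t - planar_flight_marginal_density c lam x t\<bar>)
           \<in> O[at_top](\<lambda>t. 1 / t)"
proof (rule bigoI)
  define K where "K = 3 / 2 + lam * \<bar>x\<bar> / (2 * c)"
  have K: "K > 0"
    using assms by (simp add: K_def add_pos_nonneg)
  show "\<forall>\<^sub>F t in at_top.
      norm \<bar>telegraph_density c lam x t - planar_flight_marginal_density c lam x t\<bar>
        \<le> (2 * K / c) * norm (1 / t)"
    using eventually_gt_at_top[of "2 * \<bar>x\<bar> / c"]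
  proof eventually_elim
    case (elim t)
    have x2: "2 * \<bar>x\<bar> < c * t"
      using elim assms by (simp add: field_simps)
    then have x: "\<bar>x\<bar> < c * t" and ct: "c * t > 0"
      by linarith+
    then have t: "t > 0"
      using assms(1) by (rule_tac zero_less_mult_pos)
    have "(c * t / 2)\<^sup>2 \<le> c\<^sup>2 * t\<^sup>2 - x\<^sup>2"
    proof -
      have "(2 * \<bar>x\<bar>)\<^sup>2 \<le> (c * t)\<^sup>2"
        using x2 by (intro power_mono) auto
      then have "4 * x\<^sup>2 \<le> (c * t)\<^sup>2"
        by (simp add: power_mult_distrib)
      moreover have "(c * t / 2)\<^sup>2 = (c * t)\<^sup>2 / 4" "0 \<le> (c * t)\<^sup>2"
        by (simp_all add: power_divide)
      ultimately show ?thesis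
        unfolding power_mult_distrib[symmetric] by linarith
    qed
    then have s: "c * t / 2 \<le> sqrt (c\<^sup>2 * t\<^sup>2 - x\<^sup>2)"
      using ct by (intro real_le_rsqrt)
    have "\<bar>telegraph_density c lam x t - planar_flight_marginal_density c lam x t\<bar>
        \<le> K / sqrt (c\<^sup>2 * t\<^sup>2 - x\<^sup>2)"
      unfolding K_def by (rule telegraph_planar_density_diff_le[OF assms x])
    also have "\<dots> \<le> K / (c * t / 2)"
    proof (rule divide_left_mono[OF s])
      have "0 < c * t / 2" "0 < sqrt (c\<^sup>2 * t\<^sup>2 - x\<^sup>2)"
        using s ct by linarith+
      then show "0 < sqrt (c\<^sup>2 * t\<^sup>2 - x\<^sup>2) * (c * t / 2)"
        by (rule_tac mult_pos_pos)
    qed (use K in simp)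
    also have "\<dots> = (2 * K / c) * norm (1 / t)"
      using t by simp
    finally show ?case
      by simp
  qed
qed

end
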